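(* Let $f\in\mathrm{Homeo}_+(\mathcal S)$ and let $\delta_0:\mathbb R\to\mathbb R$ be its displacement function at level $k=0$. Let $K:\mathcal S\to\Omega(\delta_0)$ be the continuous surjective homomorphism with $K(\sigma(t))=\delta_0^t$ for all $t\in\mathbb R$, and let $g:\Omega(\delta_0)\to\Omega(\delta_0)$ be given by $g(\gamma)=\gamma*\delta_0^{\gamma(0)}$. Then $g$ is semi-conjugated to $f$ by $K$, i.e. $K\circ f=g\circ K$.
   Context: Universal one-dimensional solenoid: $\mathcal S=\varprojlim_n \mathbb R/n\mathbb Z$ (index set $\mathbb Z_+$ ordered by divisibility, bonding maps the canonical projections), a compact connected abelian topological group. Let $\widehat{\mathbb Z}=\varprojlim_n\mathbb Z/n\mathbb Z$, with $\mathbb Z\subset\widehat{\mathbb Z}$ densely. Equivalently $\mathcal S$ is the orbit space of $\mathbb R\times\widehat{\mathbb Z}$ under the $\mathbb Z$-action $t\cdot(x,k)=(x+t,k-t)$; let $p:\mathbb R\times\widehat{\mathbb Z}\to\mathcal S$ be the projection and $\sigma:\mathbb R\to\mathcal S$, $\sigma(t)=p(t,0)=(t\bmod n)_n$, the dense one-parameter subgroup. $\mathrm{Homeo}_+(\mathcal S)$ is the group of orientation-preserving homeomorphisms of $\mathcal S$ isotopic to the identity. Each $f\in\mathrm{Homeo}_+(\mathcal S)$ has a lift $F:\mathbb R\times\widehat{\mathbb Z}\to\mathbb R\times\widehat{\mathbb Z}$ ($p\circ F=f\circ p$) of the form $F(x,k)=(F_k(x),k)$, where each $F_k$ is an increasing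 homeomorphism of $\mathbb R$, $F$ is continuous, $F_{k-t}(x+t)=F_k(x)+t$ for all $t\in\mathbb Z$, and the displacement $\delta_k=F_k-\mathrm{id}$ is bounded and continuous. The function $(x,k)\mapsto\delta_k(x)$ is $\mathbb Z$-invariant and so induces a continuous $\overline\delta:\mathcal S\to\mathbb R$ with $f(s)=s+\sigma(\overline\delta(s))$ and $\delta_0=\overline\delta\circ\sigma$. Let $C(\mathbb R)$ be the set of continuous functions $\mathbb R\to\mathbb R$ with the compact-open topology; $\varphi^t(x)=\varphi(x+t)$; $\Omega(\varphi)$ is the closure in $C(\mathbb R)$ of $\{\varphi^t:t\in\mathbb R\}$. The hull $\Omega(\delta_0)$ is a compact abelian topological group with neutral element $\delta_0$ under $\lim_n\delta_0^{t_n}*\lim_n\delta_0^{s_n}=\lim_n\delta_0^{t_n+s_n}$. The map $\sigma(t)\mapsto\delta_0^t$ on $\sigma(\mathbb R)$ extends to the continuous surjective homomorphism $K:\mathcal S\to\Omega(\delta_0)$. *)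

theory Defs
  imports "HOL-Analysis.Analysis" "HOL-Algebra.Product_Groups"
begin

section \<open>The quotients of a ring by the multiples of n\<close>

text \<open>
  The solenoid (over the reals) and the profinite integers (over the integers) are the same
  construction for two topological rings, so it is carried out once. The points of the quotient
  by the multiples of \<^term>\<open>n\<close> are the actual cosets.
\<close>

definition add_monoid :: "'a::ab_group_add monoid" where
  "add_monoid = \<lparr>carrier = UNIV, monoid.mult = (+), one = 0\<rparr>"

definition multiples :: "nat \<Rightarrow> 'a::comm_ring_1 set" where
  "multiples n = range (\<lambda>m::int. of_nat n * of_int m)"

definition modgrp :: "nat \<Rightarrow> 'a::comm_ring_1 set monoid" where
  "modgrp n = add_monoid Mod multiples n"

definition residue :: "nat \<Rightarrow> 'a::comm_ring_1 \<Rightarrow> 'a set" where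
  "residue n x = multiples n #>\<^bsub>add_monoid\<^esub> x"

definition modtop :: "nat \<Rightarrow> 'a::{comm_ring_1,topological_space} set topology" where
  "modtop n = topology (\<lambda>U. U \<subseteq> carrier (modgrp n) \<and> open {x. residue n x \<in> U})"

text \<open>
  If \<^term>\<open>m\<close> divides \<^term>\<open>n\<close>, the canonical projection from the quotient by the multiples of
  \<^term>\<open>n\<close> onto the quotient by those of \<^term>\<open>m\<close> enlarges a coset by the multiples of
  \<^term>\<open>m\<close>, see \<open>bonding_residue\<close> below.
\<close>

definition bonding :: "nat \<Rightarrow> 'a::comm_ring_1 set \<Rightarrow> 'a set" where
  "bonding m C = multiples m <#>\<^bsub>add_monoid\<^esub> C"

definition invlim :: "(nat \<Rightarrow> 'a::comm_ring_1 set) monoid" where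
  "invlim = (product_group {0<..} modgrp)
     \<lparr>carrier := {s \<in> carrier (product_group {0<..} modgrp).
        \<forall>m n. 0 < m \<longrightarrow> 0 < n \<longrightarrow> m dvd n \<longrightarrow> bonding m (s n) = s m}\<rparr>"

definition invlim_top :: "(nat \<Rightarrow> 'a::{comm_ring_1,topological_space} set) topology" where
  "invlim_top = subtopology (product_topology modtop {0<..}) (carrier invlim)"

definition diag :: "'a::comm_ring_1 \<Rightarrow> nat \<Rightarrow> 'a set" where
  "diag x = (\<lambda>n\<in>{0<..}. residue n x)"


section \<open>The solenoid and the profinite integers\<close>

abbreviation solenoid :: "(nat \<Rightarrow> real set) monoid" where
  "solenoid \<equiv> invlim"

abbreviation solenoid_top :: "(nat \<Rightarrow> real set) topology" where
  "solenoid_top \<equiv> invlim_top"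

abbreviation Zhat :: "(nat \<Rightarrow> int set) monoid" where
  "Zhat \<equiv> invlim"

abbreviation Zhat_top :: "(nat \<Rightarrow> int set) topology" where
  "Zhat_top \<equiv> invlim_top"

abbreviation \<sigma> :: "real \<Rightarrow> nat \<Rightarrow> real set" where
  "\<sigma> \<equiv> diag"

text \<open>
  The projection sends \<open>(x, (k\<^sub>n)\<^sub>n)\<close> to \<open>(x + k\<^sub>n mod n)\<^sub>n\<close>: the image in the reals of the
  coset \<open>k\<^sub>n\<close> of integers is already a coset of the multiples of \<open>n\<close>. That this is the
  projection onto the orbit space of the action \<open>t \<cdot> (x, k) = (x + t, k - t)\<close> of the integers is
  confirmed on points by \<open>solenoid_proj_image\<close> and \<open>solenoid_proj_eq_iff\<close> below.
\<close>

definition solenoid_proj :: "real \<times> (nat \<Rightarrow> int set) \<Rightarrow> nat \<Rightarrow> real set" where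
  "solenoid_proj = (\<lambda>(x, k). \<sigma> x \<otimes>\<^bsub>solenoid\<^esub> (\<lambda>n\<in>{0<..}. real_of_int ` k n))"

text \<open>
  The path components of the solenoid are the cosets of \<open>range \<sigma>\<close>, which are oriented by
  the flow \<open>s \<mapsto> s + \<sigma> t\<close>.
\<close>

definition orientation_preserving :: "((nat \<Rightarrow> real set) \<Rightarrow> nat \<Rightarrow> real set) \<Rightarrow> bool" where
  "orientation_preserving f \<longleftrightarrow>
     (\<forall>s \<in> carrier solenoid. \<exists>h. strict_mono h \<and>
        (\<forall>t. f (s \<otimes>\<^bsub>solenoid\<^esub> \<sigma> t) = f s \<otimes>\<^bsub>solenoid\<^esub> \<sigma> (h t)))"

definition homeo_plus :: "((nat \<Rightarrow> real set) \<Rightarrow> nat \<Rightarrow> real set) set" where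
  "homeo_plus = {f. homeomorphic_map solenoid_top solenoid_top f \<and> orientation_preserving f \<and>
     homotopic_with (homeomorphic_map solenoid_top solenoid_top) solenoid_top solenoid_top
       (\<lambda>s. s) f}"

definition displacement ::
    "(real \<times> (nat \<Rightarrow> int set) \<Rightarrow> real \<times> (nat \<Rightarrow> int set)) \<Rightarrow> (nat \<Rightarrow> int set) \<Rightarrow> real \<Rightarrow> real" where
  "displacement F k x = fst (F (x, k)) - x"

definition is_lift ::
    "(real \<times> (nat \<Rightarrow> int set) \<Rightarrow> real \<times> (nat \<Rightarrow> int set)) \<Rightarrow>
     ((nat \<Rightarrow> real set) \<Rightarrow> nat \<Rightarrow> real set) \<Rightarrow> bool" where
  "is_lift F f \<longleftrightarrow>
     continuous_map (prod_topology euclideanreal Zhat_top) (prod_topology euclideanreal Zhat_top) F \<and>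
     (\<forall>k \<in> carrier Zhat.
        (\<forall>x. solenoid_proj (F (x, k)) = f (solenoid_proj (x, k))) \<and>
        (\<forall>x. snd (F (x, k)) = k) \<and>
        strict_mono (\<lambda>x. fst (F (x, k))) \<and>
        homeomorphic_map euclideanreal euclideanreal (\<lambda>x. fst (F (x, k))) \<and>
        (\<forall>t::int. \<forall>x.
           fst (F (x + real_of_int t, k \<otimes>\<^bsub>Zhat\<^esub> diag (- t))) = fst (F (x, k)) + real_of_int t) \<and>
        bounded (range (displacement F k)) \<and>
        continuous_on UNIV (displacement F k))"


section \<open>Hulls\<close>

definition compact_open_top :: "(real \<Rightarrow> real) topology" where
  "compact_open_top = topology_generated_by
     {{\<phi>. continuous_on UNIV \<phi> \<and> \<phi> ` A \<subseteq> U} | A U. compact A \<and> open U}"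

definition translate :: "(real \<Rightarrow> real) \<Rightarrow> real \<Rightarrow> real \<Rightarrow> real" where
  "translate \<phi> t = (\<lambda>x. \<phi> (x + t))"

definition hull_set :: "(real \<Rightarrow> real) \<Rightarrow> (real \<Rightarrow> real) set" where
  "hull_set \<phi> = compact_open_top closure_of range (translate \<phi>)"

definition hull_top :: "(real \<Rightarrow> real) \<Rightarrow> (real \<Rightarrow> real) topology" where
  "hull_top \<phi> = subtopology compact_open_top (hull_set \<phi>)"

text \<open>
  The product of \<open>lim translate \<phi> (t n)\<close> and \<open>lim translate \<phi> (s n)\<close> is
  \<open>lim translate \<phi> (t n + s n)\<close>, independently of the chosen sequences. The description is proper when \<open>\<phi>\<close> is almost periodic, as displacements are; for
  other \<open>\<phi>\<close> the limits need not exist.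
\<close>

definition hull_mult :: "(real \<Rightarrow> real) \<Rightarrow> (real \<Rightarrow> real) \<Rightarrow> (real \<Rightarrow> real) \<Rightarrow> real \<Rightarrow> real" where
  "hull_mult \<phi> \<alpha> \<beta> = (THE \<gamma>. \<gamma> \<in> hull_set \<phi> \<and>
     (\<forall>t s :: nat \<Rightarrow> real.
        limitin compact_open_top (\<lambda>n. translate \<phi> (t n)) \<alpha> sequentially \<longrightarrow>
        limitin compact_open_top (\<lambda>n. translate \<phi> (s n)) \<beta> sequentially \<longrightarrow>
        limitin compact_open_top (\<lambda>n. translate \<phi> (t n + s n)) \<gamma> sequentially))"

definition hull_group :: "(real \<Rightarrow> real) \<Rightarrow> (real \<Rightarrow> real) monoid" where
  "hull_group \<phi> = \<lparr>carrier = hull_set \<phi>, monoid.mult = hull_mult \<phi>, one = \<phi>\<rparr>"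

definition hull_map :: "(real \<Rightarrow> real) \<Rightarrow> (real \<Rightarrow> real) \<Rightarrow> real \<Rightarrow> real" where
  "hull_map \<phi> \<gamma> = \<gamma> \<otimes>\<^bsub>hull_group \<phi>\<^esub> translate \<phi> (\<gamma> 0)"


section \<open>Checks of the encoding\<close>

lemma residue_eq: "residue n x = {x + of_nat n * of_int m | m. True}"
  unfolding residue_def r_coset_def multiples_def add_monoid_def
  by auto

lemma carrier_modgrp: "carrier (modgrp n) = range (residue n)"
  by (auto simp: modgrp_def carrier_FactGroup residue_def add_monoid_def)

lemma istopology_modtop:
  "istopology (\<lambda>U. U \<subseteq> carrier (modgrp n) \<and> open {x. residue n x \<in> U})"
  unfolding istopology_def
proof (intro conjI allI impI; (elim conjE)?)
  fix S T :: "'a set set"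
  assume "open {x. residue n x \<in> S}" "open {x. residue n x \<in> T}"
  then have "open ({x. residue n x \<in> S} \<inter> {x. residue n x \<in> T})" by (rule open_Int)
  then show "open {x. residue n x \<in> S \<inter> T}" by (simp add: Collect_conj_eq)
next
  fix \<K> :: "'a set set set"
  assume "\<forall>K\<in>\<K>. K \<subseteq> carrier (modgrp n) \<and> open {x. residue n x \<in> K}"
  then have "open (\<Union>K\<in>\<K>. {x. residue n x \<in> K})" by auto
  moreover have "(\<Union>K\<in>\<K>. {x. residue n x \<in> K}) = {x. residue n x \<in> \<Union>\<K>}" by auto
  ultimately show "open {x. residue n x \<in> \<Union>\<K>}" by simp
qed auto

lemma openin_modtop:
  "openin (modtop n) U \<longleftrightarrow> U \<subseteq> carrier (modgrp n) \<and> open {x. residue n x \<in> U}"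
  by (simp add: modtop_def istopology_modtop)

lemma topspace_modtop: "topspace (modtop n) = carrier (modgrp n)"
proof -
  have "openin (modtop n) (carrier (modgrp n :: 'a set monoid))"
    by (simp add: openin_modtop carrier_modgrp)
  then show ?thesis
    by (metis openin_modtop openin_subset openin_topspace subset_antisym)
qed

lemma quotient_map_residue: "quotient_map euclidean (modtop n) (residue n)"
  by (auto simp: quotient_map_def openin_modtop topspace_modtop carrier_modgrp)

lemma bonding_residue:
  assumes "m dvd n"
  shows "bonding m (residue n x) = residue m x"
proof -
  from assms obtain d where d: "n = m * d" by (auto simp: dvd_def)
  show ?thesis
  proof (intro Set.set_eqI iffI)
    fix y assume "y \<in> bonding m (residue n x)"
    then obtain i j :: int where "y = of_nat m * of_int i + (x + of_nat n * of_int j)"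
      by (auto simp: bonding_def set_mult_def add_monoid_def multiples_def residue_eq)
    then have "y = x + of_nat m * of_int (i + int d * j)"
      by (simp add: d algebra_simps)
    then show "y \<in> residue m x" unfolding residue_eq by blast
  next
    fix y assume "y \<in> residue m x"
    then obtain i :: int where "y = x + of_nat m * of_int i" by (auto simp: residue_eq)
    then have "y = of_nat m * of_int i + (x + of_nat n * of_int 0)" by simp
    moreover have "of_nat m * of_int i \<in> multiples m" "x + of_nat n * of_int 0 \<in> residue n x"
      unfolding multiples_def residue_eq by blast+
    ultimately show "y \<in> bonding m (residue n x)"
      unfolding bonding_def set_mult_def add_monoid_def by auto
  qed
qed

lemma residue_eq_iff: "residue n x = residue n y \<longleftrightarrow> (\<exists>j::int. y = x + of_nat n * of_int j)"
proof
  have "y + of_nat n * of_int 0 \<in> residue n y" unfolding residue_eq by blast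
  moreover assume "residue n x = residue n y"
  ultimately have "y \<in> residue n x" by simp
  then show "\<exists>j::int. y = x + of_nat n * of_int j" by (simp add: residue_eq)
next
  assume "\<exists>j::int. y = x + of_nat n * of_int j"
  then obtain j :: int where j: "y = x + of_nat n * of_int j" ..
  have "x + of_nat n * of_int i = y + of_nat n * of_int (i - j)" for i
    by (simp add: j algebra_simps)
  moreover have "y + of_nat n * of_int i = x + of_nat n * of_int (j + i)" for i
    by (simp add: j algebra_simps)
  ultimately show "residue n x = residue n y" unfolding residue_eq by blast
qed

lemma residue_mult: "residue n x \<otimes>\<^bsub>modgrp n\<^esub> residue n y = residue n (x + y)"
proof (intro Set.set_eqI iffI)
  fix z assume "z \<in> residue n x \<otimes>\<^bsub>modgrp n\<^esub> residue n y"
  then obtain i j :: int where "z = (x + of_nat n * of_int i) + (y + of_nat n * of_int j)"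
    by (auto simp: modgrp_def FactGroup_def set_mult_def add_monoid_def residue_eq)
  then have "z = x + y + of_nat n * of_int (i + j)" by (simp add: algebra_simps)
  then show "z \<in> residue n (x + y)" unfolding residue_eq by blast
next
  fix z assume "z \<in> residue n (x + y)"
  then obtain i :: int where "z = x + y + of_nat n * of_int i" by (auto simp: residue_eq)
  then have z: "z = (x + of_nat n * of_int i) + (y + of_nat n * of_int 0)"
    by (simp add: algebra_simps)
  have "x + of_nat n * of_int i \<in> residue n x" "y + of_nat n * of_int 0 \<in> residue n y"
    unfolding residue_eq by blast+
  with z show "z \<in> residue n x \<otimes>\<^bsub>modgrp n\<^esub> residue n y"
    unfolding modgrp_def FactGroup_def set_mult_def add_monoid_def by auto
qed

lemma image_residue: "real_of_int ` residue n c = residue n (real_of_int c)"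
  by (force simp: residue_eq)

lemma in_invlim_iff:
  "s \<in> carrier invlim \<longleftrightarrow>
     (\<exists>c. s = (\<lambda>n\<in>{0<..}. residue n (c n)) \<and>
        (\<forall>m n. 0 < m \<longrightarrow> 0 < n \<longrightarrow> m dvd n \<longrightarrow> residue m (c n) = residue m (c m)))"
proof
  assume s: "s \<in> carrier invlim"
  then have "\<forall>n\<in>{0<..}. s n \<in> range (residue n)"
    by (simp add: invlim_def product_group_def carrier_modgrp PiE_iff)
  then have "\<forall>n\<in>{0<..}. \<exists>c. s n = residue n c"
    by blast
  then obtain c where c: "\<And>n. 0 < n \<Longrightarrow> s n = residue n (c n)"
    by (metis greaterThan_iff)
  have "s = (\<lambda>n\<in>{0<..}. residue n (c n))"
    using s c by (auto simp: invlim_def product_group_def PiE_iff extensional_def fun_eq_iff)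
  moreover have "residue m (c n) = residue m (c m)" if "0 < m" "0 < n" "m dvd n" for m n
  proof -
    have "bonding m (s n) = s m" using that s by (simp add: invlim_def)
    then show ?thesis using that by (simp only: c bonding_residue)
  qed
  ultimately show "\<exists>c. s = (\<lambda>n\<in>{0<..}. residue n (c n)) \<and>
      (\<forall>m n. 0 < m \<longrightarrow> 0 < n \<longrightarrow> m dvd n \<longrightarrow> residue m (c n) = residue m (c m))"
    by (intro exI[of _ c]) blast
next
  assume "\<exists>c. s = (\<lambda>n\<in>{0<..}. residue n (c n)) \<and>
      (\<forall>m n. 0 < m \<longrightarrow> 0 < n \<longrightarrow> m dvd n \<longrightarrow> residue m (c n) = residue m (c m))"
  then obtain c where s: "s = (\<lambda>n\<in>{0<..}. residue n (c n))"
    and c: "\<And>m n. 0 < m \<Longrightarrow> 0 < n \<Longrightarrow> m dvd n \<Longrightarrow> residue m (c n) = residue m (c m)"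
    by blast
  have "bonding m (s n) = s m" if "0 < m" "0 < n" "m dvd n" for m n
    using c[OF that] that by (simp only: s restrict_def greaterThan_iff if_True bonding_residue)
  then show "s \<in> carrier invlim"
    by (simp add: invlim_def product_group_def carrier_modgrp s)
qed

lemma invlim_memI:
  assumes "\<And>m n. 0 < m \<Longrightarrow> 0 < n \<Longrightarrow> m dvd n \<Longrightarrow> residue m (c n) = residue m (c m)"
  shows "(\<lambda>n\<in>{0<..}. residue n (c n)) \<in> carrier invlim"
  using assms by (subst in_invlim_iff) (intro exI[of _ c], blast)

lemma invlim_memE:
  assumes "s \<in> carrier invlim"
  obtains c where "s = (\<lambda>n\<in>{0<..}. residue n (c n))"
    "\<And>m n. 0 < m \<Longrightarrow> 0 < n \<Longrightarrow> m dvd n \<Longrightarrow> residue m (c n) = residue m (c m)"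
  using assms unfolding in_invlim_iff by auto

lemma diag_in_invlim: "diag x \<in> carrier invlim"
  unfolding diag_def by (rule invlim_memI) simp

lemma invlim_mult:
  "(\<lambda>n\<in>{0<..}. residue n (a n)) \<otimes>\<^bsub>invlim\<^esub> (\<lambda>n\<in>{0<..}. residue n (b n)) =
   (\<lambda>n\<in>{0<..}. residue n (a n + b n))"
  by (auto simp: invlim_def product_group_def residue_mult fun_eq_iff)

lemma invlim_one: "\<one>\<^bsub>invlim\<^esub> = diag 0"
  by (auto simp: invlim_def product_group_def modgrp_def FactGroup_def diag_def residue_eq
      multiples_def fun_eq_iff)

lemma residue_add_cong:
  assumes "residue n x = residue n x'" "residue n y = residue n y'"
  shows "residue n (x + y) = residue n (x' + y')"
  by (metis assms residue_mult)

lemma comm_group_invlim: "comm_group (invlim :: (nat \<Rightarrow> 'a::comm_ring_1 set) monoid)"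
proof (rule comm_groupI)
  fix s t :: "nat \<Rightarrow> 'a set"
  assume st: "s \<in> carrier invlim" "t \<in> carrier invlim"
  show "s \<otimes>\<^bsub>invlim\<^esub> t \<in> carrier invlim"
  proof (rule invlim_memE[OF st(1)], rule invlim_memE[OF st(2)])
    fix c d :: "nat \<Rightarrow> 'a"
    assume s: "s = (\<lambda>n\<in>{0<..}. residue n (c n))" and t: "t = (\<lambda>n\<in>{0<..}. residue n (d n))"
      and c: "\<And>m n. 0 < m \<Longrightarrow> 0 < n \<Longrightarrow> m dvd n \<Longrightarrow> residue m (c n) = residue m (c m)"
      and d: "\<And>m n. 0 < m \<Longrightarrow> 0 < n \<Longrightarrow> m dvd n \<Longrightarrow> residue m (d n) = residue m (d m)"
    show ?thesis
      unfolding s t invlim_mult by (intro invlim_memI residue_add_cong c d)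
  qed
  show "s \<otimes>\<^bsub>invlim\<^esub> t = t \<otimes>\<^bsub>invlim\<^esub> s"
    using st by (auto simp: in_invlim_iff invlim_mult add.commute)
next
  fix s t u :: "nat \<Rightarrow> 'a set"
  assume "s \<in> carrier invlim" "t \<in> carrier invlim" "u \<in> carrier invlim"
  then show "s \<otimes>\<^bsub>invlim\<^esub> t \<otimes>\<^bsub>invlim\<^esub> u = s \<otimes>\<^bsub>invlim\<^esub> (t \<otimes>\<^bsub>invlim\<^esub> u)"
    by (auto simp: in_invlim_iff invlim_mult add.assoc)
next
  fix s :: "nat \<Rightarrow> 'a set"
  assume s: "s \<in> carrier invlim"
  then show "\<one>\<^bsub>invlim\<^esub> \<otimes>\<^bsub>invlim\<^esub> s = s"
    by (auto simp: in_invlim_iff invlim_one diag_def invlim_mult)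
  from s obtain c where c: "s = (\<lambda>n\<in>{0<..}. residue n (c n))"
    "\<And>m n. 0 < m \<Longrightarrow> 0 < n \<Longrightarrow> m dvd n \<Longrightarrow> residue m (c n) = residue m (c m)"
    by (auto simp: in_invlim_iff)
  have "residue m (- c n) = residue m (- c m)" if "0 < m" "0 < n" "m dvd n" for m n
  proof -
    from c(2)[OF that] obtain j :: int where "c m = c n + of_nat m * of_int j"
      by (auto simp: residue_eq_iff)
    then have "- c m = - c n + of_nat m * of_int (- j)" by simp
    then show ?thesis unfolding residue_eq_iff by blast
  qed
  then have "(\<lambda>n\<in>{0<..}. residue n (- c n)) \<in> carrier invlim"
    by (rule invlim_memI)
  moreover have "(\<lambda>n\<in>{0<..}. residue n (- c n)) \<otimes>\<^bsub>invlim\<^esub> s = \<one>\<^bsub>invlim\<^esub>"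
    by (simp add: c(1) invlim_mult invlim_one diag_def)
  ultimately show "\<exists>t\<in>carrier invlim. t \<otimes>\<^bsub>invlim\<^esub> s = \<one>\<^bsub>invlim\<^esub>" by blast
qed (simp add: invlim_one diag_in_invlim)

lemma solenoid_proj_residue:
  "solenoid_proj (x, \<lambda>n\<in>{0<..}. residue n (c n)) = (\<lambda>n\<in>{0<..}. residue n (x + real_of_int (c n)))"
proof -
  have "(\<lambda>n\<in>{0<..}. real_of_int ` (\<lambda>n\<in>{0<..}. residue n (c n)) n) =
      (\<lambda>n\<in>{0<..}. residue n (real_of_int (c n)))"
    by (auto simp: image_residue fun_eq_iff)
  then show ?thesis
    by (simp only: solenoid_proj_def case_prod_conv diag_def invlim_mult)
qed

lemma residue_real_of_int_iff:
  "residue n (real_of_int a) = residue n (real_of_int b) \<longleftrightarrow> residue n a = residue n b"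
proof -
  have "real_of_int b = real_of_int a + of_nat n * of_int j \<longleftrightarrow> b = a + of_nat n * of_int j" for j
    using of_int_eq_iff[of b "a + int n * j", where 'a=real] by simp
  then show ?thesis unfolding residue_eq_iff by simp
qed

lemma solenoid_proj_image: "solenoid_proj ` (UNIV \<times> carrier Zhat) = carrier solenoid"
proof (intro equalityI subsetI)
  fix s assume "s \<in> solenoid_proj ` (UNIV \<times> carrier Zhat)"
  then obtain x k where s: "s = solenoid_proj (x, k)" and k: "k \<in> carrier Zhat" by auto
  from k obtain c where c: "k = (\<lambda>n\<in>{0<..}. residue n (c n))"
    "\<And>m n. 0 < m \<Longrightarrow> 0 < n \<Longrightarrow> m dvd n \<Longrightarrow> residue m (c n) = residue m (c m)"
    by (auto simp: in_invlim_iff)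
  have "residue m (x + real_of_int (c n)) = residue m (x + real_of_int (c m))"
    if "0 < m" "0 < n" "m dvd n" for m n
    by (rule residue_add_cong[OF refl]) (simp add: residue_real_of_int_iff c(2)[OF that])
  then show "s \<in> carrier solenoid"
    unfolding s c(1) solenoid_proj_residue by (rule invlim_memI)
next
  fix s assume "s \<in> carrier solenoid"
  then obtain a where a: "s = (\<lambda>n\<in>{0<..}. residue n (a n))"
    "\<And>m n. 0 < m \<Longrightarrow> 0 < n \<Longrightarrow> m dvd n \<Longrightarrow> residue m (a n) = residue m (a m)"
    by (auto simp: in_invlim_iff)
  have "\<exists>j::int. a n = a 1 + real_of_int j" if "0 < n" for n
    using a(2)[of 1 n, THEN sym] that by (simp add: residue_eq_iff)
  then obtain c :: "nat \<Rightarrow> int" where c: "\<And>n. 0 < n \<Longrightarrow> a n = a 1 + real_of_int (c n)"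
    by metis
  have "residue m (c n) = residue m (c m)" if "0 < m" "0 < n" "m dvd n" for m n
  proof -
    from a(2)[OF that] have "residue m (- a 1 + a n) = residue m (- a 1 + a m)"
      by (rule residue_add_cong[OF refl])
    then show ?thesis
      unfolding c[OF that(1)] c[OF that(2)] by (simp add: residue_real_of_int_iff)
  qed
  then have "(\<lambda>n\<in>{0<..}. residue n (c n)) \<in> carrier Zhat"
    by (rule invlim_memI)
  moreover have "s = solenoid_proj (a 1, \<lambda>n\<in>{0<..}. residue n (c n))"
    unfolding solenoid_proj_residue a(1) using c by (intro restrict_ext) (metis greaterThan_iff)
  ultimately show "s \<in> solenoid_proj ` (UNIV \<times> carrier Zhat)" by blast
qed

lemma solenoid_proj_eq_iff:
  assumes "k \<in> carrier Zhat" "l \<in> carrier Zhat"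
  shows "solenoid_proj (x, k) = solenoid_proj (y, l) \<longleftrightarrow>
    (\<exists>t::int. y = x + real_of_int t \<and> l = k \<otimes>\<^bsub>Zhat\<^esub> diag (- t))"
proof -
  from assms obtain c d where c: "k = (\<lambda>n\<in>{0<..}. residue n (c n))"
    and d: "l = (\<lambda>n\<in>{0<..}. residue n (d n))"
    by (auto simp: in_invlim_iff)
  have eq: "(\<lambda>n\<in>{0<..}. residue n (a n)) = (\<lambda>n\<in>{0<..}. residue n (b n)) \<longleftrightarrow>
      (\<forall>n>0. residue n (a n) = residue n (b n))" for a b :: "nat \<Rightarrow> 'b::comm_ring_1"
    by (auto simp: fun_eq_iff restrict_def)
  have shift: "residue n (x + real_of_int p) = residue n (x + real_of_int t + real_of_int q) \<longleftrightarrow>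
      residue n q = residue n (p - t)" for n p q t
  proof -
    have "residue n (x + real_of_int p) = residue n (x + real_of_int t + real_of_int q) \<longleftrightarrow>
        residue n (real_of_int (p - t)) = residue n (real_of_int q)"
      by (auto simp: residue_eq_iff algebra_simps)
    then show ?thesis unfolding residue_real_of_int_iff by metis
  qed
  have ex: "\<exists>t::int. y = x + real_of_int t"
    if "residue 1 (x + real_of_int (c 1)) = residue 1 (y + real_of_int (d 1))"
  proof -
    from that obtain j :: int where "y + real_of_int (d 1) = x + real_of_int (c 1) + real_of_int j"
      by (auto simp: residue_eq_iff)
    then have "y = x + real_of_int (c 1 + j - d 1)" by simp
    then show ?thesis ..
  qed
  have "(\<forall>n>0. residue n (x + real_of_int (c n)) = residue n (y + real_of_int (d n))) \<longleftrightarrow>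
      (\<exists>t::int. y = x + real_of_int t \<and> (\<forall>n>0. residue n (d n) = residue n (c n + - t)))"
    (is "?L \<longleftrightarrow> ?R")
  proof
    assume L: ?L
    then obtain t :: int where t: "y = x + real_of_int t" using ex by auto
    with L have "\<forall>n>0. residue n (d n) = residue n (c n - t)" by (simp only: shift)
    with t show ?R by auto
  next
    assume ?R
    then obtain t :: int where t: "y = x + real_of_int t"
      and R: "\<forall>n>0. residue n (d n) = residue n (c n + - t)" by blast
    from R show ?L unfolding t shift by simp
  qed
  then show ?thesis
    by (simp only: c d solenoid_proj_residue diag_def invlim_mult eq)
qed

end

theory Submission
  imports Defs
begin

text \<open>
  Every \<open>s = p (x, k)\<close> satisfies \<open>f s = s + \<sigma> d\<close> with \<open>d = displacement F k x\<close>, so, \<open>K\<close> being a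
  homomorphism, it suffices that \<open>K s\<close> takes the value \<open>d\<close> at \<open>0\<close>. For an integer \<open>k\<close> this is the
  equivariance of \<open>F\<close>. A general \<open>k = (c\<^sub>n)\<^sub>n\<close> is the limit of the integers \<open>c\<^bsub>j!\<^esub>\<close>, and both
  \<open>K s 0\<close> and \<open>d\<close> depend continuously on \<open>k\<close>.
\<close>

text \<open>Convergence in the inverse limit is coordinatewise, and an eventually constant
  coordinate converges in any topology. The ring stays general so that both \<open>Zhat\<close> and
  the solenoid are covered.\<close>

lemma limitin_invlim_diag:
  fixes a c :: "nat \<Rightarrow> 'a::{comm_ring_1,topological_space}"
  assumes mem: "(\<lambda>n\<in>{0<..}. residue n (c n)) \<in> carrier invlim"
    and ev: "\<And>n. 0 < n \<Longrightarrow> eventually (\<lambda>j. residue n (a j) = residue n (c n)) sequentially"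
  shows "limitin invlim_top (\<lambda>j. diag (a j)) (\<lambda>n\<in>{0<..}. residue n (c n)) sequentially"
proof -
  have "limitin (modtop n) (\<lambda>j. diag (a j) n) (residue n (c n)) sequentially" if "0 < n" for n
  proof (rule limitin_eventually)
    show "residue n (c n) \<in> topspace (modtop n)"
      by (simp add: topspace_modtop carrier_modgrp)
    show "eventually (\<lambda>j. diag (a j) n = residue n (c n)) sequentially"
      using ev[OF that] by eventually_elim (simp add: diag_def that)
  qed
  then have "limitin (product_topology modtop {0<..}) (\<lambda>j. diag (a j))
      (\<lambda>n\<in>{0<..}. residue n (c n)) sequentially"
    unfolding limitin_componentwise
    by (auto simp: PiE_iff diag_def topspace_modtop carrier_modgrp)
  then show ?thesis
    unfolding invlim_top_def by (simp add: limitin_subtopology mem diag_in_invlim)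
qed

text \<open>Factorials are cofinal for divisibility: \<open>n\<close> divides \<open>fact j\<close>
  as soon as \<open>j\<close> is at least \<open>n\<close>.\<close>

lemma eventually_residue_fact_eq:
  assumes "\<And>m n. 0 < m \<Longrightarrow> 0 < n \<Longrightarrow> m dvd n \<Longrightarrow> residue m (c n) = residue m (c m)" and "0 < n"
  shows "eventually (\<lambda>j. residue n (c (fact j)) = residue n (c n)) sequentially"
  using eventually_ge_at_top[of n]
  by eventually_elim (rule assms(1), use \<open>0 < n\<close> in \<open>simp_all add: dvd_fact\<close>)

lemma continuous_map_eval_compact_open: "continuous_map compact_open_top euclideanreal (\<lambda>\<phi>. \<phi> x)"
proof -
  have "openin compact_open_top {\<phi> \<in> topspace compact_open_top. \<phi> x \<in> U}" if "open U" for U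
  proof -
    let ?S = "\<lambda>A V. {\<phi>::real \<Rightarrow> real. continuous_on UNIV \<phi> \<and> \<phi> ` A \<subseteq> V}"
    have basis: "openin compact_open_top (?S A V)" if "compact A" "open V" for A V
      unfolding compact_open_top_def
      by (rule topology_generated_by_Basis) (rule CollectI, rule exI[of _ A], rule exI[of _ V], simp add: that)
    have "topspace compact_open_top = {\<phi>. continuous_on UNIV \<phi>}"
    proof
      show "topspace compact_open_top \<subseteq> {\<phi>. continuous_on UNIV \<phi>}"
        by (auto simp: compact_open_top_def topology_generated_by_topspace)
      \<comment> \<open>The subbasic set for the empty compact set consists of all continuous
        functions.\<close>
      show "{\<phi>. continuous_on UNIV \<phi>} \<subseteq> topspace compact_open_top"
        using openin_subset[OF basis[of "{}" UNIV]] by simp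
    qed
    \<comment> \<open>Points are compact, so the preimage of \<open>U\<close> under evaluation at
      \<open>x\<close> is itself subbasic.\<close>
    then have "{\<phi> \<in> topspace compact_open_top. \<phi> x \<in> U} = ?S {x} U"
      by simp
    then show ?thesis
      using basis[of "{x}" U] that by simp
  qed
  then show ?thesis
    by (auto simp: continuous_map_def)
qed

lemma solenoid_proj_add:
  assumes "k \<in> carrier Zhat"
  shows "solenoid_proj (x + d, k) = solenoid_proj (x, k) \<otimes>\<^bsub>solenoid\<^esub> \<sigma> d"
  using assms
  by (rule invlim_memE) (simp add: solenoid_proj_residue diag_def invlim_mult algebra_simps)

lemma is_lift_eq:
  assumes "is_lift F f" "k \<in> carrier Zhat"
  shows "F (x, k) = (x + displacement F k x, k)"
  using assms by (simp add: is_lift_def displacement_def prod_eq_iff)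

text \<open>Equivariance under the integer \<open>t\<close> carries the level \<open>diag t\<close>
  to the neutral level, and the added \<open>t\<close> cancels in the displacement.\<close>

lemma displacement_diag:
  assumes "is_lift F f"
  shows "displacement F (diag t) x = displacement F \<one>\<^bsub>Zhat\<^esub> (x + real_of_int t)"
proof -
  have "diag t \<otimes>\<^bsub>Zhat\<^esub> diag (- t) = \<one>\<^bsub>Zhat\<^esub>"
    by (simp add: diag_def invlim_mult invlim_one)
  moreover have "fst (F (x + real_of_int t, diag t \<otimes>\<^bsub>Zhat\<^esub> diag (- t))) =
      fst (F (x, diag t)) + real_of_int t"
    using assms diag_in_invlim by (auto simp: is_lift_def)
  ultimately show ?thesis
    by (simp add: displacement_def)
qed

text \<open>Both sides are limits of the one real sequence
  \<open>displacement F (diag (t j)) x\<close>.\<close>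

lemma value_at_0_eq_displacement:
  assumes F: "is_lift F f"
    and K_cont: "continuous_map solenoid_top (hull_top (displacement F \<one>\<^bsub>Zhat\<^esub>)) K"
    and K_\<sigma>: "\<And>t. K (\<sigma> t) = translate (displacement F \<one>\<^bsub>Zhat\<^esub>) t"
    and k: "k \<in> carrier Zhat"
  shows "K (solenoid_proj (x, k)) 0 = displacement F k x"
proof -
  from k obtain c where c: "k = (\<lambda>n\<in>{0<..}. residue n (c n))"
    "\<And>m n. 0 < m \<Longrightarrow> 0 < n \<Longrightarrow> m dvd n \<Longrightarrow> residue m (c n) = residue m (c m)"
    by (auto simp: in_invlim_iff)
  define t where "t j = c (fact j)" for j
  have ev: "eventually (\<lambda>j. residue n (t j) = residue n (c n)) sequentially" if "0 < n" for n
    using eventually_residue_fact_eq[of c, OF c(2) that] by (simp add: t_def)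
  have "limitin Zhat_top (\<lambda>j. diag (t j)) k sequentially"
    using k unfolding c(1) by (rule limitin_invlim_diag) (rule ev)
  then have "limitin (prod_topology euclideanreal Zhat_top) (\<lambda>j. (x, diag (t j))) (x, k) sequentially"
    by (simp add: limitin_pairwise o_def)
  \<comment> \<open>The level varies while \<open>x\<close> is fixed, so continuity of
    \<open>F\<close> on the product is what counts, not that of a single level.\<close>
  moreover have "continuous_map (prod_topology euclideanreal Zhat_top) euclideanreal (\<lambda>q. fst (F q))"
    using F unfolding is_lift_def by (blast intro: continuous_map_fst_of[unfolded o_def])
  ultimately have "(\<lambda>j. fst (F (x, diag (t j)))) \<longlonglongrightarrow> fst (F (x, k))"
    by (auto dest: continuous_map_limit simp: o_def)
  then have lim_disp: "(\<lambda>j. displacement F (diag (t j)) x) \<longlonglongrightarrow> displacement F k x"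
    unfolding displacement_def by (intro tendsto_intros)

  have s: "solenoid_proj (x, k) = (\<lambda>n\<in>{0<..}. residue n (x + real_of_int (c n)))"
    by (simp only: c(1) solenoid_proj_residue)
  \<comment> \<open>The point \<open>\<sigma> (x + t j)\<close> is the projection of
    \<open>(x, diag (t j))\<close>; congruences between integers persist in the reals and under
    adding \<open>x\<close>.\<close>
  have "limitin solenoid_top (\<lambda>j. \<sigma> (x + real_of_int (t j))) (solenoid_proj (x, k)) sequentially"
    unfolding s
  proof (rule limitin_invlim_diag)
    show "(\<lambda>n\<in>{0<..}. residue n (x + real_of_int (c n))) \<in> carrier solenoid"
      unfolding s[symmetric] using k solenoid_proj_image by blast
    show "eventually (\<lambda>j. residue n (x + real_of_int (t j)) = residue n (x + real_of_int (c n)))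
        sequentially" if "0 < n" for n
      using ev[OF that] by eventually_elim (rule residue_add_cong[OF refl], simp only: residue_real_of_int_iff)
  qed
  moreover have "continuous_map solenoid_top euclideanreal (\<lambda>s. K s 0)"
    using continuous_map_compose[OF continuous_map_into_fulltopology continuous_map_eval_compact_open]
      K_cont unfolding hull_top_def o_def by blast
  ultimately have "(\<lambda>j. K (\<sigma> (x + real_of_int (t j))) 0) \<longlonglongrightarrow> K (solenoid_proj (x, k)) 0"
    by (auto dest: continuous_map_limit simp: o_def)
  \<comment> \<open>On the dense subgroup, \<open>K (\<sigma> r) 0\<close> is the neutral
    displacement at \<open>r\<close>; with \<open>r = x + t j\<close> it is the displacement of
    \<open>x\<close> at level \<open>diag (t j)\<close>.\<close>
  then have "(\<lambda>j. displacement F (diag (t j)) x) \<longlonglongrightarrow> K (solenoid_proj (x, k)) 0"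
    by (simp add: K_\<sigma> translate_def displacement_diag[OF F])
  then show ?thesis
    using lim_disp by (rule LIMSEQ_unique)
qed

theorem theorem3p2:
  fixes f :: "(nat \<Rightarrow> real set) \<Rightarrow> (nat \<Rightarrow> real set)"
    and F :: "real \<times> (nat \<Rightarrow> int set) \<Rightarrow> real \<times> (nat \<Rightarrow> int set)"
    and K :: "(nat \<Rightarrow> real set) \<Rightarrow> (real \<Rightarrow> real)"
    and \<delta>\<^sub>0 :: "real \<Rightarrow> real"
  assumes f: "f \<in> homeo_plus"
    and F: "is_lift F f"
    and \<delta>\<^sub>0: "\<delta>\<^sub>0 = displacement F \<one>\<^bsub>Zhat\<^esub>"
    and K_cont: "continuous_map solenoid_top (hull_top \<delta>\<^sub>0) K"
    and K_surj: "K ` carrier solenoid = carrier (hull_group \<delta>\<^sub>0)"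
    and K_hom: "K \<in> hom solenoid (hull_group \<delta>\<^sub>0)"
    and K_\<sigma>: "\<And>t. K (\<sigma> t) = translate \<delta>\<^sub>0 t"
  shows "\<forall>s \<in> carrier solenoid. K (f s) = hull_map \<delta>\<^sub>0 (K s)"
proof
  fix s assume s: "s \<in> carrier solenoid"
  then obtain x k where xk: "s = solenoid_proj (x, k)" and k: "k \<in> carrier Zhat"
    using solenoid_proj_image by fastforce
  have d: "K s 0 = displacement F k x"
    unfolding xk by (rule value_at_0_eq_displacement[OF F K_cont[unfolded \<delta>\<^sub>0] K_\<sigma>[unfolded \<delta>\<^sub>0] k])
  have "f s = solenoid_proj (F (x, k))"
    using F k by (simp add: is_lift_def xk)
  \<comment> \<open>Moving \<open>x\<close> by its displacement within level \<open>k\<close>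
    becomes, under the projection, adding \<open>\<sigma>\<close> of that displacement.\<close>
  also have "\<dots> = s \<otimes>\<^bsub>solenoid\<^esub> \<sigma> (K s 0)"
    by (simp only: is_lift_eq[OF F k] solenoid_proj_add[OF k] d flip: xk)
  finally have "K (f s) = K s \<otimes>\<^bsub>hull_group \<delta>\<^sub>0\<^esub> K (\<sigma> (K s 0))"
    using hom_mult[OF K_hom s diag_in_invlim] by simp
  then show "K (f s) = hull_map \<delta>\<^sub>0 (K s)"
    by (simp add: hull_map_def K_\<sigma>)
qed

end
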